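(* For all $x\in V$ put $\tilde\Delta(x)=\Delta(x)-1\otimes x$ (an element of $V\otimes H$). Then: 1. $\tilde\Delta(X_\emptyset)=X_\emptyset\otimes 1$. 2. $\tilde\Delta\circ\theta_0=(\theta_0\otimes \mathrm{Id})\circ\tilde\Delta+(\theta_1\otimes m)\circ(\tilde\Delta\otimes \mathrm{Id})\circ\Delta_{\sqcup\!\sqcup}$ as maps $V\to V\otimes H$. 3. $\tilde\Delta\circ\theta_1=(\theta_1\otimes \mathrm{Id})\circ\tilde\Delta$ as maps $V\to V\otimes H$.
   Context: $\mathbb{K}$ is a field of characteristic zero. $\mathbb{K}\langle\langle x_0,x_1\rangle\rangle$ is the space of noncommutative formal series in $x_0,x_1$, with its usual ultrametric topology; it is an algebra for concatenation and for the shuffle product $\sqcup\!\sqcup$ (determined by $\emptyset\sqcup\!\sqcup w=w\sqcup\!\sqcup\emptyset=w$ and $au\sqcup\!\sqcup bv=a(u\sqcup\!\sqcup bv)+b(au\sqcup\!\sqcup v)$ for letters $a,b$ and words $u,v,w$, extended bilinearly and continuously). $\emptyset$ is the empty word. For $d\in\mathbb{K}\langle\langle x_0,x_1\rangle\rangle$, $\varphi_d$ is the continuous algebra map (for concatenation) from $\mathbb{K}\langle\langle x_0,x_1\rangle\rangle$ to $\mathrm{End}(\mathbb{K}\langle\langle x_0,x_1\rangle\rangle)$ such that $\varphi_d(x_0)(X)=x_0X$ and $\varphi_d(x_1)(X)=x_1X+x_0(d\sqcup\!\sqcup X)$ for all $X$. The composition $c\circ d=\varphi_d(c)(\emptyset)+d$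 is associative. For a word $c$, $X_c$ is the linear form on $\mathbb{K}\langle\langle x_0,x_1\rangle\rangle$ giving the coefficient of $c$; $V$ is the span of all the $X_c$, and $H=S(V)$ is the free commutative algebra on the $X_c$'s, with multiplication $m:H\otimes H\to H$. Elements of $H$ (resp. $H\otimes H$) are seen as polynomial functions on $\mathbb{K}\langle\langle x_0,x_1\rangle\rangle$ (resp. on its square). $\Delta:H\to H\otimes H$ is the algebra morphism such that $\Delta(X_c)(f,g)=X_c(f\circ g)$ for every word $c$ and all series $f,g$. $\Delta_{\sqcup\!\sqcup}:V\to V\otimes V$ is dual to the shuffle product: $\Delta_{\sqcup\!\sqcup}(X_w)=\sum_{u,v}X_w(u\sqcup\!\sqcup v)\,X_u\otimes X_v$, the sum being over all pairs of words. For $i=0,1$, $\theta_i:V\to V$ is the linear map with $\theta_i(X_c)=X_{x_ic}$ for every word $c$. *)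

theory Defs
  imports "HOL-Library.Poly_Mapping" "HOL-Library.Product_Plus"
    "HOL-Computational_Algebra.Polynomial"
begin

datatype letter = x0 | x1

type_synonym word = "letter list"
type_synonym 'k series = "word \<Rightarrow> 'k"

definition word_series :: "word \<Rightarrow> 'k::field series" where
  "word_series w = (\<lambda>v. if v = w then 1 else 0)"

definition conc :: "'k::field series \<Rightarrow> 'k series \<Rightarrow> 'k series" where
  "conc f g = (\<lambda>w. \<Sum>(u, v) \<in> {(u, v). u @ v = w}. f u * g v)"

fun shuffle_word :: "word \<Rightarrow> word \<Rightarrow> 'k::field series" where
  "shuffle_word [] w = word_series w"
| "shuffle_word w [] = word_series w"
| "shuffle_word (a # u) (b # v) =
     (\<lambda>w. conc (word_series [a]) (shuffle_word u (b # v)) w +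
          conc (word_series [b]) (shuffle_word (a # u) v) w)"

text \<open>Bilinear continuous extension: for fixed \<open>w\<close> only the finitely many pairs with
  \<open>length u + length v = length w\<close> contribute
  (see \<open>shuffle_word_length\<close> and \<open>finite_shuffle_support\<close> below).\<close>

definition shuffle :: "'k::field series \<Rightarrow> 'k series \<Rightarrow> 'k series" where
  "shuffle f g = (\<lambda>w. Sum_any (\<lambda>(u, v). f u * g v * shuffle_word u v w))"

fun phi_letter :: "'k::field series \<Rightarrow> letter \<Rightarrow> 'k series \<Rightarrow> 'k series" where
  "phi_letter d x0 X = conc (word_series [x0]) X"
| "phi_letter d x1 X =
     (\<lambda>v. conc (word_series [x1]) X v + conc (word_series [x0]) (shuffle d X) v)"

fun phi_word :: "'k::field series \<Rightarrow> word \<Rightarrow> 'k series \<Rightarrow> 'k series" where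
  "phi_word d [] X = X"
| "phi_word d (a # w) X = phi_letter d a (phi_word d w X)"

text \<open>The value at \<open>c\<close> of the continuous algebra map is the sum over all words \<open>w\<close> of
  \<open>c w\<close> times the product of the images of the letters of \<open>w\<close>.  For fixed \<open>v\<close> only words of
  length at most \<open>length v\<close> contribute.  Theorem \<open>continuous_alg_map_iff_phi\<close> below identifies
  \<open>phi d\<close> as the unique continuous algebra map with the prescribed values on the letters.\<close>

definition phi :: "'k::field series \<Rightarrow> 'k series \<Rightarrow> 'k series \<Rightarrow> 'k series" where
  "phi d c X = (\<lambda>v. Sum_any (\<lambda>w. c w * phi_word d w X v))"

definition series_comp :: "'k::field series \<Rightarrow> 'k series \<Rightarrow> 'k series" where
  "series_comp c d = (\<lambda>v. phi d c (word_series []) v + d v)"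

lemma finite_words [simp]: "finite {w :: word. length w \<le> n}"
proof -
  have "finite (UNIV :: letter set)"
    by (rule finite_subset[of _ "{x0, x1}"]) (auto intro: letter.exhaust)
  from finite_lists_length_le[OF this, of n] show ?thesis by simp
qed

lemma splits_eq: "{(u, v). u @ v = w} = (\<lambda>i. (take i w, drop i w)) ` {..length w}"
proof -
  have "(u, v) \<in> (\<lambda>i. (take i (u @ v), drop i (u @ v))) ` {..length (u @ v)}" for u v :: "'a list"
    by (rule image_eqI[of _ _ "length u"]) auto
  then show ?thesis by auto
qed

lemma conc_take_drop: "conc f g w = (\<Sum>i\<le>length w. f (take i w) * g (drop i w))"
proof -
  have "inj_on (\<lambda>i. (take i w, drop i w)) {..length w}"
    by (rule inj_on_inverseI[of _ "\<lambda>(u, v). length u"]) auto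
  then show ?thesis
    unfolding conc_def splits_eq by (simp add: sum.reindex)
qed

lemma conc_letter:
  "conc (word_series [a]) X w = (case w of [] \<Rightarrow> 0 | b # v \<Rightarrow> if b = a then X v else 0)"
proof (cases w)
  case Nil
  then show ?thesis by (simp add: conc_take_drop word_series_def)
next
  case (Cons b v)
  have *: "(\<Sum>i\<le>length w. word_series [a] (take i w) * X (drop i w)) =
    (\<Sum>i\<in>{1}. word_series [a] (take i w) * X (drop i w))"
  proof (rule sum.mono_neutral_right)
    show "\<forall>i\<in>{..length w} - {1}. word_series [a] (take i w) * X (drop i w) = 0"
    proof
      fix i assume "i \<in> {..length w} - {1}"
      then have "length (take i w) \<noteq> length [a]" by auto
      then have "take i w \<noteq> [a]" by metis
      then show "word_series [a] (take i w) * X (drop i w) = 0" by (simp add: word_series_def)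
    qed
  qed (use Cons in auto)
  show ?thesis unfolding conc_take_drop * by (simp add: Cons word_series_def)
qed

lemma conc_word_series: "conc (word_series u) (word_series v) = word_series (u @ v)"
proof
  fix w :: word
  have fin: "finite {(u', v'). u' @ v' = w}" by (simp add: splits_eq)
  have "conc (word_series u) (word_series v) w =
    (\<Sum>p\<in>{(u', v'). u' @ v' = w}. if p = (u, v) then 1 else 0)"
    unfolding conc_def by (rule sum.cong) (auto simp: word_series_def split: if_splits)
  then show "conc (word_series u) (word_series v) w = word_series (u @ v) w"
    using fin by (auto simp: word_series_def)
qed

lemma shuffle_word_length:
  "shuffle_word u v w \<noteq> (0 :: 'k::field) \<Longrightarrow> length w = length u + length v"
proof (induction u v arbitrary: w rule: shuffle_word.induct)
  case (3 a u b v)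
  from 3(3) obtain c w' where w: "w = c # w'"
    by (cases w) (auto simp: conc_letter)
  from 3(3) have "shuffle_word u (b # v) w' \<noteq> (0::'k) \<or> shuffle_word (a # u) v w' \<noteq> (0::'k)"
    by (auto simp: conc_letter w split: if_splits)
  then show ?case using 3(1,2) w by auto
qed (auto simp: word_series_def split: if_splits)

lemma finite_shuffle_support:
  "finite {(u, v). f u * g v * shuffle_word u v w \<noteq> (0 :: 'k::field)}"
  by (rule finite_subset[of _ "{u. length u \<le> length w} \<times> {u. length u \<le> length w}"])
     (auto simp: shuffle_word_length)

lemma shuffle_expand:
  assumes "length w \<le> n"
  shows "shuffle f g w =
    (\<Sum>u | length u \<le> n. \<Sum>v | length v \<le> n. f u * g v * shuffle_word u v w)"
proof -
  have "shuffle f g w =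
    (\<Sum>(u, v)\<in>{u. length u \<le> n} \<times> {u. length u \<le> n}. f u * g v * shuffle_word u v w)"
    unfolding shuffle_def
    by (rule Sum_any.expand_superset) (use assms in \<open>auto simp: shuffle_word_length\<close>)
  then show ?thesis by (simp add: sum.cartesian_product)
qed

lemma phi_letter_local:
  assumes "\<And>v. length v < n \<Longrightarrow> X v = Y v" and "length v \<le> n"
  shows "phi_letter d a X v = phi_letter d a Y v"
proof -
  have "shuffle d X v' = shuffle d Y v'" if "length v' < n" for v'
    unfolding shuffle_expand[OF order.refl]
    by (intro sum.cong refl) (use assms(1) that in auto)
  then show ?thesis
    using assms by (cases a; cases v) (auto simp: conc_letter)
qed

lemma phi_word_local:
  assumes "\<And>v. length v \<le> n \<Longrightarrow> X v = Y v" and "length v \<le> n"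
  shows "phi_word d w X v = phi_word d w Y v"
  using assms(2)
proof (induction w arbitrary: v)
  case (Cons a w)
  show ?case unfolding phi_word.simps
    by (rule phi_letter_local[of n]) (use Cons in auto)
qed (use assms in auto)

lemma shuffle_sum:
  assumes "finite A"
  shows "shuffle d (\<lambda>v. \<Sum>i\<in>A. a i * X i v) = (\<lambda>v. \<Sum>i\<in>A. a i * shuffle d (X i) v)"
proof
  fix w :: word
  have "shuffle d (\<lambda>v. \<Sum>i\<in>A. a i * X i v) w =
    (\<Sum>u | length u \<le> length w. \<Sum>v | length v \<le> length w. \<Sum>i\<in>A. a i * (d u * X i v * shuffle_word u v w))"
    unfolding shuffle_expand[OF order.refl]
    by (intro sum.cong refl) (simp add: sum_distrib_left sum_distrib_right mult_ac)
  also have "\<dots> = (\<Sum>u | length u \<le> length w. \<Sum>i\<in>A. \<Sum>v | length v \<le> length w. a i * (d u * X i v * shuffle_word u v w))"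
    by (intro sum.cong refl sum.swap)
  also have "\<dots> = (\<Sum>i\<in>A. \<Sum>u | length u \<le> length w. \<Sum>v | length v \<le> length w. a i * (d u * X i v * shuffle_word u v w))"
    by (rule sum.swap)
  also have "\<dots> = (\<Sum>i\<in>A. a i * shuffle d (X i) w)"
    unfolding shuffle_expand[OF order.refl] by (simp add: sum_distrib_left)
  finally show "shuffle d (\<lambda>v. \<Sum>i\<in>A. a i * X i v) w = (\<Sum>i\<in>A. a i * shuffle d (X i) w)" .
qed

lemma phi_word_sum:
  assumes "finite A"
  shows "phi_word d w (\<lambda>v. \<Sum>i\<in>A. a i * X i v) = (\<lambda>v. \<Sum>i\<in>A. a i * phi_word d w (X i) v)"
proof (induction w)
  case (Cons l w)
  show ?case
  proof
    fix v :: word show "phi_word d (l # w) (\<lambda>v. \<Sum>i\<in>A. a i * X i v) v = (\<Sum>i\<in>A. a i * phi_word d (l # w) (X i) v)"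
      by (cases l; cases v) (auto simp: Cons conc_letter shuffle_sum[OF assms] sum.distrib algebra_simps)
  qed
qed simp

lemma phi_word_append: "phi_word d (u @ v) X = phi_word d u (phi_word d v X)"
  by (induction u) auto

lemma phi_word_zero: "length v < length w \<Longrightarrow> phi_word d w X v = 0"
proof (induction w arbitrary: v)
  case (Cons a w)
  have "shuffle d (phi_word d w X) v' = 0" if "Suc (length v') = length v" for v'
    unfolding shuffle_expand[OF order.refl]
    by (intro sum.neutral ballI) (use that Cons in auto)
  then show ?case using Cons by (cases a; cases v) (auto simp: conc_letter)
qed simp

lemma phi_expand:
  assumes "length v \<le> n"
  shows "phi d c X v = (\<Sum>w | length w \<le> n. c w * phi_word d w X v)"
  unfolding phi_def
proof (rule Sum_any.expand_superset)
  show "{w. c w * phi_word d w X v \<noteq> 0} \<subseteq> {w. length w \<le> n}"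
  proof clarify
    fix w assume "c w * phi_word d w X v \<noteq> 0"
    then have "\<not> length v < length w" using phi_word_zero by (metis mult_zero_right)
    then show "length w \<le> n" using assms by simp
  qed
qed simp

definition agree :: "nat \<Rightarrow> 'k series \<Rightarrow> 'k series \<Rightarrow> bool" where
  "agree n f g \<longleftrightarrow> (\<forall>v. length v < n \<longrightarrow> f v = g v)"

definition linear_series :: "('k::field series \<Rightarrow> 'k series) \<Rightarrow> bool" where
  "linear_series F \<longleftrightarrow>
     (\<forall>a b X Y. F (\<lambda>v. a * X v + b * Y v) = (\<lambda>v. a * F X v + b * F Y v))"

text \<open>Algebra maps from series to endomorphisms, continuous for the ultrametric topology on the
  series and pointwise convergence on the endomorphisms: two series are \<open>n\<close>-close iff they agree
  on all words of length less than \<open>n\<close>.\<close>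

definition continuous_alg_map :: "('k::field series \<Rightarrow> 'k series \<Rightarrow> 'k series) \<Rightarrow> bool" where
  "continuous_alg_map \<Phi> \<longleftrightarrow>
     (\<forall>c. linear_series (\<Phi> c)) \<and> (\<forall>X. linear_series (\<lambda>c. \<Phi> c X)) \<and>
     \<Phi> (word_series []) = id \<and> (\<forall>c c'. \<Phi> (conc c c') = \<Phi> c \<circ> \<Phi> c') \<and>
     (\<forall>X c n. \<exists>m. \<forall>c'. agree m c c' \<longrightarrow> agree n (\<Phi> c X) (\<Phi> c' X))"

lemma phi_word_series: "phi d (word_series w) X v = phi_word d w X v"
proof -
  define n where "n = max (length v) (length w)"
  have "phi d (word_series w) X v = (\<Sum>u | length u \<le> n. if u = w then phi_word d w X v else 0)"
    unfolding phi_expand[of v n, OF max.cobounded1[of "length v" "length w", folded n_def]]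
    by (intro sum.cong refl) (auto simp: word_series_def)
  then show ?thesis by (simp add: n_def)
qed

lemma phi_conc: "phi d (conc c c') X = phi d c (phi d c' X)"
proof
  fix v :: word
  define n where "n = length v"
  define W where "W = {w::word. length w \<le> n}"
  have fin[simp]: "finite W" by (simp add: W_def)
  have A: "phi d c' X v' = (\<Sum>w\<in>W. c' w * phi_word d w X v')" if "length v' \<le> n" for v'
    using phi_expand[OF that] by (simp add: W_def)
  have "phi d c (phi d c' X) v = (\<Sum>u\<in>W. c u * phi_word d u (phi d c' X) v)"
    using phi_expand[of v n d c] by (simp add: W_def n_def)
  also have "\<dots> = (\<Sum>u\<in>W. c u * phi_word d u (\<lambda>v. \<Sum>w\<in>W. c' w * phi_word d w X v) v)"
    by (intro sum.cong refl arg_cong2[of _ _ _ _ "(*)"] phi_word_local[of n]) (auto simp: A n_def)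
  also have "\<dots> = (\<Sum>u\<in>W. \<Sum>w\<in>W. c u * c' w * phi_word d (u @ w) X v)"
    by (simp add: phi_word_sum phi_word_append sum_distrib_left mult_ac)
  also have "\<dots> = (\<Sum>(u, w)\<in>W \<times> W. c u * c' w * phi_word d (u @ w) X v)"
    by (simp add: sum.cartesian_product)
  also have "\<dots> = (\<Sum>(u, w)\<in>{(u, w). u @ w \<in> W}. c u * c' w * phi_word d (u @ w) X v)"
  proof (rule sum.mono_neutral_right)
    show "\<forall>i\<in>W \<times> W - {(u, w). u @ w \<in> W}. (case i of (u, w) \<Rightarrow> c u * c' w * phi_word d (u @ w) X v) = 0"
      using phi_word_zero[of v _ d X]
      by (auto simp: W_def n_def) (metis length_append not_le)
  qed (auto simp: W_def)
  also have "\<dots> = (\<Sum>w\<in>W. \<Sum>(u, u')\<in>{(u, u'). u @ u' = w}. c u * c' u' * phi_word d (u @ u') X v)"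
  proof -
    have f: "finite {(u, u'). u @ u' = w}" for w :: word
      by (simp add: splits_eq)
    have "{(u, w). u @ w \<in> W} = (\<Union>w\<in>W. {(u, u'). u @ u' = w})" by auto
    then show ?thesis
      by (simp only:) (rule sum.UNION_disjoint, use f in auto)
  qed
  also have "\<dots> = (\<Sum>w\<in>W. conc c c' w * phi_word d w X v)"
    unfolding conc_def by (intro sum.cong refl) (auto simp: sum_distrib_right intro!: sum.cong)
  also have "\<dots> = phi d (conc c c') X v"
    using phi_expand[of v n d "conc c c'" X] by (simp add: W_def n_def)
  finally show "phi d (conc c c') X v = phi d c (phi d c' X) v" by simp
qed

lemma phi_word_linear:
  "phi_word d w (\<lambda>v. a * X v + b * Y v) = (\<lambda>v. a * phi_word d w X v + b * phi_word d w Y v)"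
  using phi_word_sum[of "UNIV :: bool set" d w "\<lambda>i. if i then a else b" "\<lambda>i. if i then X else Y"]
  by (simp add: UNIV_bool add.commute)

lemma continuous_alg_map_phi: "continuous_alg_map (phi d)"
  unfolding continuous_alg_map_def
proof (intro conjI allI)
  show "linear_series (phi d c)" for c
    unfolding linear_series_def
    by (intro allI ext) (simp add: phi_expand[OF order.refl] phi_word_linear sum_distrib_left
      sum.distrib algebra_simps)
  show "linear_series (\<lambda>c. phi d c X)" for X
    unfolding linear_series_def
    by (intro allI ext) (simp add: phi_expand[OF order.refl] sum_distrib_left
      sum.distrib algebra_simps)
  show "phi d (word_series []) = id"
    by (intro ext) (simp add: phi_word_series)
  show "phi d (conc c c') = phi d c \<circ> phi d c'" for c c'
    by (intro ext) (simp add: phi_conc)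
  show "\<exists>m. \<forall>c'. agree m c c' \<longrightarrow> agree n (phi d c X) (phi d c' X)" for X c n
    by (rule exI[of _ n]) (auto simp: agree_def phi_expand[OF order.refl])
qed

lemma linear_series_sum:
  assumes "linear_series F" "finite A"
  shows "F (\<lambda>v. \<Sum>i\<in>A. a i * X i v) = (\<lambda>v. \<Sum>i\<in>A. a i * F (X i) v)"
  using assms(2)
proof (induction A)
  case empty
  have "F (\<lambda>v. 0 * undefined v + 0 * undefined v) = (\<lambda>v. 0 * F undefined v + 0 * F undefined v)"
    using assms(1) unfolding linear_series_def by blast
  then show ?case by simp
next
  case (insert i A)
  have "F (\<lambda>v. a i * X i v + 1 * (\<Sum>i\<in>A. a i * X i v)) =
    (\<lambda>v. a i * F (X i) v + 1 * F (\<lambda>v. \<Sum>i\<in>A. a i * X i v) v)"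
    by (rule assms(1)[unfolded linear_series_def, rule_format])
  then show ?case using insert by simp
qed

theorem continuous_alg_map_iff_phi:
  "\<Phi> = phi d \<longleftrightarrow>
     continuous_alg_map \<Phi> \<and>
     (\<forall>X. \<Phi> (word_series [x0]) X = conc (word_series [x0]) X) \<and>
     (\<forall>X. \<Phi> (word_series [x1]) X =
        (\<lambda>v. conc (word_series [x1]) X v + conc (word_series [x0]) (shuffle d X) v))"
  (is "_ \<longleftrightarrow> ?cont \<and> ?L0 \<and> ?L1")
proof
  assume "\<Phi> = phi d"
  then show "?cont \<and> ?L0 \<and> ?L1"
    by (auto simp: continuous_alg_map_phi phi_word_series)
next
  assume R: "?cont \<and> ?L0 \<and> ?L1"
  have letter: "\<Phi> (word_series [a]) X = phi_letter d a X" for a X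
    using R by (cases a) auto
  have word: "\<Phi> (word_series w) X = phi_word d w X" for w X
  proof (induction w)
    case Nil
    then show ?case using R by (simp add: continuous_alg_map_def)
  next
    case (Cons a w)
    have "\<Phi> (conc (word_series [a]) (word_series w)) = \<Phi> (word_series [a]) \<circ> \<Phi> (word_series w)"
      using R by (simp add: continuous_alg_map_def)
    then show ?case using Cons letter by (simp add: conc_word_series)
  qed
  show "\<Phi> = phi d"
  proof (intro ext)
    fix c X and v :: word
    obtain m where m: "\<And>c'. agree m c c' \<Longrightarrow> agree (Suc (length v)) (\<Phi> c X) (\<Phi> c' X)"
      using R unfolding continuous_alg_map_def by blast
    define n where "n = max m (length v)"
    define c' where "c' = (\<lambda>v. \<Sum>w | length w \<le> n. c w * word_series w v)"
    have "c' v = c v" if "length v \<le> n" for v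
    proof -
      have "c' v = (\<Sum>w | length w \<le> n. if w = v then c v else 0)"
        unfolding c'_def by (intro sum.cong refl) (auto simp: word_series_def)
      then show ?thesis using that by simp
    qed
    then have "agree m c c'" by (auto simp: agree_def n_def)
    then have "\<Phi> c X v = \<Phi> c' X v" using m by (auto simp: agree_def)
    also have "\<Phi> c' X = (\<lambda>v. \<Sum>w | length w \<le> n. c w * \<Phi> (word_series w) X v)"
      unfolding c'_def
      by (rule linear_series_sum[of "\<lambda>c. \<Phi> c X"]) (use R in \<open>auto simp: continuous_alg_map_def\<close>)
    also have "\<dots> v = phi d c X v"
      by (simp add: word phi_expand[of v n] n_def)
    finally show "\<Phi> c X v = phi d c X v" .
  qed
qed

text \<open>A vector space with basis indexed by \<open>'a\<close> is \<open>'a \<Rightarrow>\<^sub>0 'k\<close>, and the tensor product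
  of the spaces with bases \<open>'a\<close> and \<open>'b\<close> is the space with basis \<open>'a \<times> 'b\<close>.  The symmetric
  algebra on the coordinates \<open>X\<^sub>c\<close> has the monomials \<open>word \<Rightarrow>\<^sub>0 nat\<close> as basis, and the
  convolution product of \<open>Poly_Mapping\<close> is its multiplication.  Monomials in both factors are
  added componentwise, so the product on \<open>'k HH\<close> is that of the algebra \<open>H \<otimes> H\<close>.\<close>

type_synonym 'k V = "word \<Rightarrow>\<^sub>0 'k"
type_synonym 'k H = "(word \<Rightarrow>\<^sub>0 nat) \<Rightarrow>\<^sub>0 'k"
type_synonym 'k VV = "(word \<times> word) \<Rightarrow>\<^sub>0 'k"
type_synonym 'k VH = "(word \<times> (word \<Rightarrow>\<^sub>0 nat)) \<Rightarrow>\<^sub>0 'k"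
type_synonym 'k HH = "((word \<Rightarrow>\<^sub>0 nat) \<times> (word \<Rightarrow>\<^sub>0 nat)) \<Rightarrow>\<^sub>0 'k"

definition scl :: "'k::field \<Rightarrow> ('a \<Rightarrow>\<^sub>0 'k) \<Rightarrow> ('a \<Rightarrow>\<^sub>0 'k)" where
  "scl a p = Poly_Mapping.map ((*) a) p"

text \<open>The linear map with prescribed values on the basis.\<close>

definition lin :: "('a \<Rightarrow> ('b \<Rightarrow>\<^sub>0 'k)) \<Rightarrow> ('a \<Rightarrow>\<^sub>0 'k::field) \<Rightarrow> ('b \<Rightarrow>\<^sub>0 'k)" where
  "lin f p = (\<Sum>a\<in>Poly_Mapping.keys p. scl (Poly_Mapping.lookup p a) (f a))"

lift_definition tensor :: "('a \<Rightarrow>\<^sub>0 'k::field) \<Rightarrow> ('b \<Rightarrow>\<^sub>0 'k) \<Rightarrow> ('a \<times> 'b) \<Rightarrow>\<^sub>0 'k"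
  is "\<lambda>p q (a, b). p a * q b"
proof -
  fix p :: "'a \<Rightarrow> 'k" and q :: "'b \<Rightarrow> 'k"
  assume "finite {x. p x \<noteq> 0}" "finite {x. q x \<noteq> 0}"
  then have "finite ({x. p x \<noteq> 0} \<times> {x. q x \<noteq> 0})" by simp
  then show "finite {x. (case x of (a, b) \<Rightarrow> p a * q b) \<noteq> 0}"
    by (rule rev_finite_subset) auto
qed

definition tensor_map ::
  "(('a \<Rightarrow>\<^sub>0 'k) \<Rightarrow> ('c \<Rightarrow>\<^sub>0 'k)) \<Rightarrow> (('b \<Rightarrow>\<^sub>0 'k) \<Rightarrow> ('d \<Rightarrow>\<^sub>0 'k)) \<Rightarrow>
    (('a \<times> 'b) \<Rightarrow>\<^sub>0 'k::field) \<Rightarrow> (('c \<times> 'd) \<Rightarrow>\<^sub>0 'k)" where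
  "tensor_map F G = lin (\<lambda>(a, b). tensor (F (Poly_Mapping.single a 1)) (G (Poly_Mapping.single b 1)))"

definition tensor_assoc :: "((('a \<times> 'b) \<times> 'c) \<Rightarrow>\<^sub>0 'k::field) \<Rightarrow> (('a \<times> ('b \<times> 'c)) \<Rightarrow>\<^sub>0 'k)" where
  "tensor_assoc = lin (\<lambda>((a, b), c). Poly_Mapping.single (a, (b, c)) 1)"

definition coord :: "word \<Rightarrow> 'k::field V" where
  "coord c = Poly_Mapping.single c 1"

definition V_to_H :: "'k::field V \<Rightarrow> 'k H" where
  "V_to_H = lin (\<lambda>c. Poly_Mapping.single (Poly_Mapping.single c 1) 1)"

definition mult_H :: "'k::field HH \<Rightarrow> 'k H" where
  "mult_H = lin (\<lambda>(m, n). Poly_Mapping.single m 1 * Poly_Mapping.single n 1)"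

definition theta :: "letter \<Rightarrow> 'k::field V \<Rightarrow> 'k V" where
  "theta a = lin (\<lambda>c. coord (a # c))"

definition Delta_shuffle :: "'k::field V \<Rightarrow> 'k VV" where
  "Delta_shuffle = lin (\<lambda>w. Sum_any (\<lambda>(u, v). scl (shuffle_word u v w) (tensor (coord u) (coord v))))"

definition eval_mon :: "(word \<Rightarrow>\<^sub>0 nat) \<Rightarrow> 'k::field series \<Rightarrow> 'k" where
  "eval_mon m f = (\<Prod>c\<in>Poly_Mapping.keys m. f c ^ Poly_Mapping.lookup m c)"

definition eval_H :: "'k::field H \<Rightarrow> 'k series \<Rightarrow> 'k" where
  "eval_H p f = (\<Sum>m\<in>Poly_Mapping.keys p. Poly_Mapping.lookup p m * eval_mon m f)"

definition eval_HH :: "'k::field HH \<Rightarrow> 'k series \<Rightarrow> 'k series \<Rightarrow> 'k" where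
  "eval_HH p f g =
    (\<Sum>(m, n)\<in>Poly_Mapping.keys p. Poly_Mapping.lookup p (m, n) * (eval_mon m f * eval_mon n g))"

definition is_Delta :: "('k::field H \<Rightarrow> 'k HH) \<Rightarrow> bool" where
  "is_Delta D \<longleftrightarrow>
     Vector_Spaces.linear scl scl D \<and> D 1 = 1 \<and> (\<forall>p q. D (p * q) = D p * D q) \<and>
     (\<forall>c f g. eval_HH (D (V_to_H (coord c))) f g = eval_H (V_to_H (coord c)) (series_comp f g))"

text \<open>Existence and uniqueness over a field of characteristic zero: theorem \<open>ex1_Delta\<close> below.\<close>

definition Delta :: "'k::field H \<Rightarrow> 'k HH" where
  "Delta = (THE D. is_Delta D)"

definition VH_to_HH :: "'k::field VH \<Rightarrow> 'k HH" where
  "VH_to_HH = tensor_map V_to_H id"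

text \<open>The element of \<open>V \<otimes> H\<close> whose image in \<open>H \<otimes> H\<close> is \<open>\<Delta>(x) - 1 \<otimes> x\<close>;
  the inclusion is injective (\<open>inj_VH_to_HH\<close> below).\<close>

definition Delta_tilde :: "'k::field V \<Rightarrow> 'k VH" where
  "Delta_tilde x = (THE y. VH_to_HH y = Delta (V_to_H x) - tensor 1 (V_to_H x))"

lemma lookup_scl [simp]: "Poly_Mapping.lookup (scl a p) x = a * Poly_Mapping.lookup p x"
  unfolding scl_def by (simp add: Poly_Mapping.map.rep_eq when_def)

lemma vector_space_scl: "vector_space (scl :: 'k::field \<Rightarrow> ('a \<Rightarrow>\<^sub>0 'k) \<Rightarrow> _)"
  by unfold_locales (auto intro!: poly_mapping_eqI simp: lookup_add algebra_simps)

lemma linear_scl_iff: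
  "Vector_Spaces.linear scl scl (D :: ('a \<Rightarrow>\<^sub>0 'k::field) \<Rightarrow> ('b \<Rightarrow>\<^sub>0 'k)) \<longleftrightarrow>
     (\<forall>p q. D (p + q) = D p + D q) \<and> (\<forall>a p. D (scl a p) = scl a (D p))"
  unfolding Vector_Spaces.linear_def module_hom_def module_hom_axioms_def
  using vector_space_scl[where 'a = 'a and 'k = 'k] vector_space_scl[where 'a = 'b and 'k = 'k]
  by (auto simp: module_iff_vector_space)

lemma scl_single [simp]: "scl a (Poly_Mapping.single x b) = Poly_Mapping.single x (a * b)"
  by (rule poly_mapping_eqI) (simp add: lookup_single when_def)

lemma scl_add_left: "scl (a + b) p = scl a p + scl b p"
  by (rule poly_mapping_eqI) (simp add: lookup_add algebra_simps)

lemma lookup_lin: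
  assumes "finite A" "Poly_Mapping.keys p \<subseteq> A"
  shows "lin f p = (\<Sum>a\<in>A. scl (Poly_Mapping.lookup p a) (f a))"
  unfolding lin_def
  by (rule sum.mono_neutral_left) (use assms in \<open>auto intro!: poly_mapping_eqI simp: in_keys_iff\<close>)

lemma lin_add: "lin f (p + q) = lin f p + lin f q"
proof -
  define A where "A = Poly_Mapping.keys p \<union> Poly_Mapping.keys q"
  have A: "finite A" "Poly_Mapping.keys p \<subseteq> A" "Poly_Mapping.keys q \<subseteq> A"
    "Poly_Mapping.keys (p + q) \<subseteq> A"
    using keys_add[of p q] by (auto simp: A_def)
  show ?thesis
    by (simp add: lookup_lin[of A] A lookup_add sum.distrib[symmetric] scl_add_left)
qed

lemma lin_scl:
  fixes f :: "'a \<Rightarrow> 'b \<Rightarrow>\<^sub>0 'k::field"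
  shows "lin f (scl a p) = scl a (lin f p)"
proof -
  have A: "Poly_Mapping.keys (scl a p) \<subseteq> Poly_Mapping.keys p"
    by (auto simp: in_keys_iff)
  interpret vector_space "scl :: 'k \<Rightarrow> ('b \<Rightarrow>\<^sub>0 'k) \<Rightarrow> _" by (rule vector_space_scl)
  show ?thesis
    unfolding lookup_lin[OF finite_keys A] unfolding lin_def by (simp add: scale_sum_right)
qed

lemma lin_single [simp]: "lin f (Poly_Mapping.single a c) = scl c (f a)"
  by (auto simp: lin_def intro!: poly_mapping_eqI)

lemma poly_mapping_sum_single:
  "p = (\<Sum>a\<in>Poly_Mapping.keys p. Poly_Mapping.single a (Poly_Mapping.lookup p a))"
  by (rule poly_mapping_eqI) (auto simp: lookup_sum lookup_single when_def in_keys_iff)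

lemma inj_VH_to_HH: "inj (VH_to_HH :: 'k::field VH \<Rightarrow> 'k HH)"
proof (rule injI)
  fix x y :: "'k VH" assume eq: "VH_to_HH x = VH_to_HH y"
  have L: "Poly_Mapping.lookup (VH_to_HH z) (Poly_Mapping.single c 1, n) = Poly_Mapping.lookup z (c, n)"
    for z :: "'k VH" and c n
  proof -
    have "Poly_Mapping.lookup (VH_to_HH z) (Poly_Mapping.single c 1, n) =
      (\<Sum>p\<in>Poly_Mapping.keys z. if p = (c, n) then Poly_Mapping.lookup z (c, n) else 0)"
      unfolding VH_to_HH_def tensor_map_def lin_def lookup_sum
      by (rule sum.cong)
         (auto simp: V_to_H_def tensor.rep_eq lookup_single when_def split: if_splits
            dest!: arg_cong[of "Poly_Mapping.single _ _" _ Poly_Mapping.keys])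
    then show ?thesis by (simp add: in_keys_iff)
  qed
  show "x = y"
    by (rule poly_mapping_eqI) (metis L eq prod.collapse)
qed

lemma monomials_independent:
  fixes c :: "'m \<Rightarrow> 'k::field_char_0" and e :: "'m \<Rightarrow> 'v \<Rightarrow> nat"
  assumes "finite A" "finite M"
    "\<And>m m'. m \<in> M \<Longrightarrow> m' \<in> M \<Longrightarrow> (\<And>v. v \<in> A \<Longrightarrow> e m v = e m' v) \<Longrightarrow> m = m'"
    "\<And>f. (\<Sum>m\<in>M. c m * (\<Prod>v\<in>A. f v ^ e m v)) = 0" "m0 \<in> M"
  shows "c m0 = 0"
  using assms
proof (induction A arbitrary: M m0)
  case empty
  then have "M = {m0}" by auto
  then show ?case using empty(3)[of undefined] by simp
next
  case (insert a A)
  have *: "(\<Sum>m\<in>{m\<in>M. e m a = e m0 a}. c m * (\<Prod>v\<in>A. f v ^ e m v)) = 0" for f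
  proof -
    define p where "p = (\<Sum>m\<in>M. monom (c m * (\<Prod>v\<in>A. f v ^ e m v)) (e m a))"
    have "poly p t = 0" for t
    proof -
      have "(\<Sum>m\<in>M. c m * (\<Prod>v\<in>insert a A. (f(a := t)) v ^ e m v)) = 0"
        by (rule insert.prems)
      moreover have "(\<Prod>v\<in>A. (f(a := t)) v ^ e m v) = (\<Prod>v\<in>A. f v ^ e m v)" for m
        by (rule prod.cong) (use insert.hyps in auto)
      ultimately show ?thesis
        using insert.hyps by (simp add: p_def poly_sum poly_monom mult_ac)
    qed
    then have "p = 0" using poly_all_0_iff_0 by blast
    then have "coeff p (e m0 a) = 0" by simp
    then show ?thesis
      using insert.prems(1) unfolding p_def coeff_sum
      by (simp add: sum.inter_filter[symmetric] if_distrib[of "\<lambda>x. x = _"] eq_commute[of _ "e m0 a"])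
  qed
  show ?case
  proof (rule insert.IH[of "{m\<in>M. e m a = e m0 a}"])
    fix m m' assume "m \<in> {m\<in>M. e m a = e m0 a}" "m' \<in> {m\<in>M. e m a = e m0 a}"
      "\<And>v. v \<in> A \<Longrightarrow> e m v = e m' v"
    then show "m = m'" by (intro insert.prems(2)) auto
  qed (use insert.prems(1,4) in \<open>simp_all add: *\<close>)
qed

lemma eval_HH_eq_0:
  fixes p :: "'k::field_char_0 HH"
  assumes "\<And>f g. eval_HH p f g = 0"
  shows "p = 0"
proof -
  let ?M = "Poly_Mapping.keys p"
  let ?e = "\<lambda>(m, n). case_sum (Poly_Mapping.lookup m) (Poly_Mapping.lookup n)"
  define B where "B = (\<Union>(m, n)\<in>?M. Poly_Mapping.keys m \<union> Poly_Mapping.keys n)"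
  have finB: "finite B" by (auto simp: B_def)
  have keysB: "Poly_Mapping.keys m \<subseteq> B" "Poly_Mapping.keys n \<subseteq> B"
    if "(m, n) \<in> ?M" for m n
    using UN_upper[OF that, of "\<lambda>(m, n). Poly_Mapping.keys m \<union> Poly_Mapping.keys n"]
    unfolding B_def by simp_all
  have B: "Poly_Mapping.lookup m c = 0" "Poly_Mapping.lookup n c = 0"
    if "(m, n) \<in> ?M" "c \<notin> B" for m n c
    using keysB[OF that(1)] that(2) by (meson in_keys_iff subsetD)+
  have eval: "eval_mon m f = (\<Prod>c\<in>B. f c ^ Poly_Mapping.lookup m c)"
    if "Poly_Mapping.keys m \<subseteq> B" for m and f :: "'k series"
    unfolding eval_mon_def
    by (rule prod.mono_neutral_left) (use finB that in \<open>auto simp: in_keys_iff\<close>)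
  have "Poly_Mapping.lookup p k = 0" for k
  proof (cases "k \<in> ?M")
    case True
    show ?thesis
    proof (rule monomials_independent[of "B <+> B" ?M ?e])
      fix x y assume xy: "x \<in> ?M" "y \<in> ?M" "\<And>v. v \<in> B <+> B \<Longrightarrow> ?e x v = ?e y v"
      obtain m n m' n' where [simp]: "x = (m, n)" "y = (m', n')" by (cases x; cases y) auto
      have "Poly_Mapping.lookup m c = Poly_Mapping.lookup m' c" for c
        using xy(3)[of "Inl c"] B xy(1,2) by (cases "c \<in> B") auto
      moreover have "Poly_Mapping.lookup n c = Poly_Mapping.lookup n' c" for c
        using xy(3)[of "Inr c"] B xy(1,2) by (cases "c \<in> B") auto
      ultimately show "x = y" by (auto intro: poly_mapping_eqI)
    next
      fix f :: "word + word \<Rightarrow> 'k"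
      have "eval_HH p (f \<circ> Inl) (f \<circ> Inr) =
        (\<Sum>k\<in>?M. Poly_Mapping.lookup p k * (\<Prod>v\<in>B <+> B. f v ^ ?e k v))"
        unfolding eval_HH_def
      proof (rule sum.cong)
        fix k assume "k \<in> ?M"
        moreover obtain m n where k: "k = (m, n)" by (cases k)
        ultimately have "Poly_Mapping.keys m \<subseteq> B" "Poly_Mapping.keys n \<subseteq> B"
          using keysB by blast+
        then show "(case k of (m, n) \<Rightarrow> Poly_Mapping.lookup p (m, n) *
            (eval_mon m (f \<circ> Inl) * eval_mon n (f \<circ> Inr))) =
          Poly_Mapping.lookup p k * (\<Prod>v\<in>B <+> B. f v ^ ?e k v)"
          using finB by (simp add: k eval prod.Plus)
      qed simp
      then show "(\<Sum>k\<in>?M. Poly_Mapping.lookup p k * (\<Prod>v\<in>B <+> B. f v ^ ?e k v)) = 0"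
        using assms by simp
    qed (use True finB in auto)
  qed (simp add: in_keys_iff)
  then show ?thesis by (intro poly_mapping_eqI) simp
qed

text \<open>\<open>ev \<psi> e\<close> extends a map on the basis semilinearly; it covers \<open>lin\<close>, \<open>eval_H\<close> and \<open>eval_HH\<close>.\<close>

definition ev :: "('k::field \<Rightarrow> 'r::comm_ring_1) \<Rightarrow> ('m \<Rightarrow> 'r) \<Rightarrow> ('m \<Rightarrow>\<^sub>0 'k) \<Rightarrow> 'r" where
  "ev \<psi> e p = (\<Sum>m\<in>Poly_Mapping.keys p. \<psi> (Poly_Mapping.lookup p m) * e m)"

definition ring_map :: "('k::field \<Rightarrow> 'r::comm_ring_1) \<Rightarrow> bool" where
  "ring_map \<psi> \<longleftrightarrow> \<psi> 1 = 1 \<and> \<psi> 0 = 0 \<and> (\<forall>a b. \<psi> (a + b) = \<psi> a + \<psi> b) \<and> (\<forall>a b. \<psi> (a * b) = \<psi> a * \<psi> b)"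

lemma ev_superset:
  assumes "ring_map \<psi>" "finite A" "Poly_Mapping.keys p \<subseteq> A"
  shows "ev \<psi> e p = (\<Sum>m\<in>A. \<psi> (Poly_Mapping.lookup p m) * e m)"
  unfolding ev_def
  by (rule sum.mono_neutral_left) (use assms in \<open>auto simp: in_keys_iff ring_map_def\<close>)

lemma ev_add:
  assumes "ring_map \<psi>"
  shows "ev \<psi> e (p + q) = ev \<psi> e p + ev \<psi> e q"
proof -
  define A where "A = Poly_Mapping.keys p \<union> Poly_Mapping.keys q"
  have A: "finite A" "Poly_Mapping.keys p \<subseteq> A" "Poly_Mapping.keys q \<subseteq> A"
    "Poly_Mapping.keys (p + q) \<subseteq> A"
    using keys_add[of p q] by (auto simp: A_def)
  show ?thesis
    using assms
    by (simp add: ev_superset[OF assms A(1)] A(2-) lookup_add ring_map_def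
        sum.distrib[symmetric] algebra_simps)
qed

lemma ev_0 [simp]: "ev \<psi> e 0 = 0"
  by (simp add: ev_def)

lemma ev_sum:
  assumes "ring_map \<psi>"
  shows "ev \<psi> e (\<Sum>i\<in>A. p i) = (\<Sum>i\<in>A. ev \<psi> e (p i))"
  by (induction A rule: infinite_finite_induct) (simp_all add: ev_add[OF assms])

lemma ev_single:
  assumes "ring_map \<psi>"
  shows "ev \<psi> e (Poly_Mapping.single m a) = \<psi> a * e m"
  using assms by (simp add: ev_def ring_map_def)

lemma ev_mult:
  assumes "ring_map \<psi>" "\<And>m n. e (m + n) = e m * e n"
  shows "ev \<psi> e (p * q) = ev \<psi> e p * ev \<psi> e q"
proof -
  have "ev \<psi> e (p * q) =
    ev \<psi> e ((\<Sum>a\<in>Poly_Mapping.keys p. Poly_Mapping.single a (Poly_Mapping.lookup p a)) *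
      (\<Sum>a\<in>Poly_Mapping.keys q. Poly_Mapping.single a (Poly_Mapping.lookup q a)))"
    by (simp only: poly_mapping_sum_single[symmetric])
  also have "\<dots> = (\<Sum>a\<in>Poly_Mapping.keys p. \<Sum>b\<in>Poly_Mapping.keys q.
      \<psi> (Poly_Mapping.lookup p a * Poly_Mapping.lookup q b) * e (a + b))"
    by (simp add: sum_product ev_sum[OF assms(1)] mult_single ev_single[OF assms(1)])
  also have "\<dots> = ev \<psi> e p * ev \<psi> e q"
    using assms(1) unfolding ev_def sum_product
    by (simp add: assms(2) ring_map_def mult_ac)
  finally show ?thesis .
qed

lemma ev_scl:
  assumes "ring_map \<psi>"
  shows "ev \<psi> e (scl a p) = \<psi> a * ev \<psi> e p"
proof -
  have A: "Poly_Mapping.keys (scl a p) \<subseteq> Poly_Mapping.keys p"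
    by (auto simp: in_keys_iff)
  show ?thesis
    unfolding ev_superset[OF assms finite_keys A] unfolding ev_def
    using assms by (simp add: ring_map_def sum_distrib_left mult_ac)
qed

lemma ring_map_id: "ring_map (\<lambda>x. x)"
  by (simp add: ring_map_def)

lemma ring_map_single: "ring_map (Poly_Mapping.single (0 :: 'a::comm_monoid_add))"
  by (simp add: ring_map_def single_add mult_single)

lemma scl_conv_mult: "scl a p = Poly_Mapping.single 0 a * p"
  by (simp add: scl_def mult_map_scale_conv_mult)

lemma lin_ev: "lin f = ev (Poly_Mapping.single (0 :: 'a::comm_monoid_add)) f"
  by (intro ext) (simp add: lin_def ev_def scl_conv_mult)

definition mon :: "(word \<Rightarrow> 'r::comm_ring_1) \<Rightarrow> (word \<Rightarrow>\<^sub>0 nat) \<Rightarrow> 'r" where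
  "mon f m = (\<Prod>c\<in>Poly_Mapping.keys m. f c ^ Poly_Mapping.lookup m c)"

lemma mon_superset:
  assumes "finite A" "Poly_Mapping.keys m \<subseteq> A"
  shows "mon f m = (\<Prod>c\<in>A. f c ^ Poly_Mapping.lookup m c)"
  unfolding mon_def
  by (rule prod.mono_neutral_left) (use assms in \<open>auto simp: in_keys_iff\<close>)

lemma mon_add: "mon f (m + n) = mon f m * mon f n"
proof -
  define A where "A = Poly_Mapping.keys m \<union> Poly_Mapping.keys n"
  have A: "finite A" "Poly_Mapping.keys m \<subseteq> A" "Poly_Mapping.keys n \<subseteq> A"
    "Poly_Mapping.keys (m + n) \<subseteq> A"
    using keys_add[of m n] by (auto simp: A_def)
  show ?thesis
    by (simp add: mon_superset[OF A(1)] A(2-) lookup_add power_add prod.distrib)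
qed

lemma mon_0 [simp]: "mon f 0 = 1"
  by (simp add: mon_def)

lemma mon_single: "mon f (Poly_Mapping.single c 1) = f c"
  by (simp add: mon_def)

lemma eval_H_ev: "eval_H p f = ev (\<lambda>x. x) (mon f) p"
  by (simp add: eval_H_def ev_def eval_mon_def mon_def)

lemma eval_HH_ev: "eval_HH p f g = ev (\<lambda>x. x) (\<lambda>(m, n). mon f m * mon g n) p"
  by (auto simp: eval_HH_def ev_def eval_mon_def mon_def intro!: sum.cong)

lemma eval_HH_tensor: "eval_HH (tensor p q) f g = eval_H p f * eval_H q g"
proof -
  have "eval_HH (tensor p q) f g = (\<Sum>(m, n)\<in>Poly_Mapping.keys p \<times> Poly_Mapping.keys q.
    Poly_Mapping.lookup p m * Poly_Mapping.lookup q n * (mon f m * mon g n))"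
    unfolding eval_HH_ev
    by (subst ev_superset[OF ring_map_id, of "Poly_Mapping.keys p \<times> Poly_Mapping.keys q"])
       (auto simp: tensor.rep_eq in_keys_iff intro!: sum.cong)
  also have "\<dots> = eval_H p f * eval_H q g"
    by (simp add: eval_H_ev ev_def sum_product sum.cartesian_product mult_ac)
  finally show ?thesis .
qed

definition gen :: "word \<Rightarrow> 'k::field H" where
  "gen c = Poly_Mapping.single (Poly_Mapping.single c 1) 1"

lemma V_to_H_coord: "V_to_H (coord c) = gen c"
  by (simp add: V_to_H_def coord_def gen_def)

lemma eval_H_gen [simp]: "eval_H (gen c) f = f c"
  by (simp add: gen_def eval_H_ev ev_single[OF ring_map_id] mon_single[simplified])

lemma eval_H_add: "eval_H (p + q) f = eval_H p f + eval_H q f"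
  by (simp add: eval_H_ev ev_add[OF ring_map_id])

lemma eval_H_sum: "eval_H (\<Sum>i\<in>A. p i) f = (\<Sum>i\<in>A. eval_H (p i) f)"
  by (simp add: eval_H_ev ev_sum[OF ring_map_id])

lemma eval_H_mult: "eval_H (p * q) f = eval_H p f * eval_H q f"
  by (simp add: eval_H_ev ev_mult[OF ring_map_id mon_add])

lemma eval_H_scl: "eval_H (scl a p) f = a * eval_H p f"
  by (simp add: eval_H_ev ev_scl[OF ring_map_id])

lemma eval_H_0 [simp]: "eval_H 0 f = 0"
  by (simp add: eval_H_ev)

lemma eval_H_1 [simp]: "eval_H 1 f = 1"
  using ev_single[OF ring_map_id, of "mon f" 0 1] by (simp add: eval_H_ev)

fun phi_poly :: "word \<Rightarrow> word \<Rightarrow> 'k::field H" where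
  "phi_poly [] v = (if v = [] then 1 else 0)"
| "phi_poly (a # w) [] = 0"
| "phi_poly (a # w) (b # v) =
     (if b = a then phi_poly w v else 0) +
     (if a = x1 \<and> b = x0 then
        \<Sum>u | length u \<le> length v. \<Sum>t | length t \<le> length v.
          scl (shuffle_word u t v) (gen u * phi_poly w t)
      else 0)"

lemma eval_phi_poly: "eval_H (phi_poly w v) g = phi_word g w (word_series []) v"
proof (induction w arbitrary: v)
  case Nil
  then show ?case by (simp add: word_series_def)
next
  case (Cons a w)
  show ?case
  proof (cases v)
    case Nil
    then show ?thesis by (cases a) (simp_all add: conc_letter)
  next
    case (Cons b t)
    then show ?thesis
      by (cases a; cases b)
         (simp_all add: conc_letter eval_H_add eval_H_sum eval_H_scl eval_H_mult Cons.IH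
           shuffle_expand[OF order.refl] mult_ac)
  qed
qed

lemma polynomial_series_comp:
  "eval_HH ((\<Sum>w | length w \<le> length c. tensor (gen w) (phi_poly w c)) + tensor 1 (gen c)) f g =
     series_comp f g c"
  by (simp add: eval_HH_ev ev_add[OF ring_map_id] ev_sum[OF ring_map_id])
     (simp add: eval_HH_ev[symmetric] eval_HH_tensor eval_phi_poly series_comp_def
       phi_expand[OF order.refl])

lemma single_eq_mon: "Poly_Mapping.single m 1 = (mon gen m :: 'k::field H)"
proof -
  have pow: "Poly_Mapping.single (Poly_Mapping.single c k) 1 = (gen c :: 'k H) ^ k" for c k
  proof (induction k)
    case (Suc k)
    have "Poly_Mapping.single (Poly_Mapping.single c (Suc k)) (1::'k) =
      gen c * Poly_Mapping.single (Poly_Mapping.single c k) 1"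
      by (simp add: gen_def mult_single single_add[symmetric])
    then show ?case using Suc by simp
  qed simp
  have "Poly_Mapping.single (\<Sum>c\<in>A. Poly_Mapping.single c (Poly_Mapping.lookup m c)) 1 =
      (\<Prod>c\<in>A. (gen c :: 'k H) ^ Poly_Mapping.lookup m c)" for A
  proof (induction A rule: infinite_finite_induct)
    case (insert c A)
    have "Poly_Mapping.single (Poly_Mapping.single c (Poly_Mapping.lookup m c) +
        (\<Sum>c\<in>A. Poly_Mapping.single c (Poly_Mapping.lookup m c))) (1::'k) =
      Poly_Mapping.single (Poly_Mapping.single c (Poly_Mapping.lookup m c)) 1 *
      Poly_Mapping.single (\<Sum>c\<in>A. Poly_Mapping.single c (Poly_Mapping.lookup m c)) 1"
      by (simp add: mult_single)
    then show ?case using insert pow by simp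
  qed simp_all
  from this[of "Poly_Mapping.keys m"] show ?thesis
    by (simp add: mon_def poly_mapping_sum_single[symmetric])
qed

lemma alg_hom_eq_lin:
  assumes "Vector_Spaces.linear scl scl (D :: 'k::field H \<Rightarrow> 'k HH)" "D 1 = 1"
    "\<And>p q. D (p * q) = D p * D q"
  shows "D = lin (mon (D \<circ> gen))"
proof
  fix p
  have add: "D (p + q) = D p + D q" and scl: "D (scl a p) = scl a (D p)" for p q a
    using assms(1) by (auto simp: linear_scl_iff)
  have D0: "D 0 = 0" using add[of 0 0] by simp
  have sum: "D (\<Sum>i\<in>A. q i) = (\<Sum>i\<in>A. D (q i))" for A and q :: "(word \<Rightarrow>\<^sub>0 nat) \<Rightarrow> 'k H"
    by (induction A rule: infinite_finite_induct) (simp_all add: add D0)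
  have prod: "D (\<Prod>i\<in>A. q i) = (\<Prod>i\<in>A. D (q i))" for A and q :: "word \<Rightarrow> 'k H"
    by (induction A rule: infinite_finite_induct) (simp_all add: assms(2,3))
  have pow: "D (q ^ n) = D q ^ n" for q n
    by (induction n) (simp_all add: assms(2,3))
  have mon: "D (mon gen m) = mon (D \<circ> gen) m" for m
    by (simp add: mon_def prod pow)
  have single: "D (Poly_Mapping.single m a) = scl a (mon (D \<circ> gen) m)" for m a
    using scl[of a "Poly_Mapping.single m 1"] mon[of m] by (simp add: single_eq_mon[symmetric])
  have "D p = D (\<Sum>m\<in>Poly_Mapping.keys p. Poly_Mapping.single m (Poly_Mapping.lookup p m))"
    by (simp only: poly_mapping_sum_single[symmetric])
  then show "D p = lin (mon (D \<circ> gen)) p"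
    by (simp add: sum single lin_def)
qed

theorem ex1_Delta: "\<exists>!D :: 'k::field_char_0 H \<Rightarrow> 'k HH. is_Delta D"
proof (rule ex_ex1I)
  define q :: "word \<Rightarrow> 'k HH" where
    "q c = (\<Sum>w | length w \<le> length c. tensor (gen w) (phi_poly w c)) + tensor 1 (gen c)" for c
  have "is_Delta (lin (mon q))"
    unfolding is_Delta_def linear_scl_iff
  proof (intro conjI allI)
    show "lin (mon q) (x + y) = lin (mon q) x + lin (mon q) y" for x y
      by (rule lin_add)
    show "lin (mon q) (scl a x) = scl a (lin (mon q) x)" for a x
      by (rule lin_scl)
    show "lin (mon q) 1 = 1"
      using lin_single[of "mon q" 0 1] by (simp add: scl_conv_mult)
    show "lin (mon q) (x * y) = lin (mon q) x * lin (mon q) y" for x y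
      unfolding lin_ev by (rule ev_mult[OF ring_map_single mon_add])
    have "lin (mon q) (gen c) = q c" for c
      by (simp add: gen_def scl_conv_mult mon_single[simplified])
    then show "eval_HH (lin (mon q) (V_to_H (coord c))) f g =
        eval_H (V_to_H (coord c)) (series_comp f g)" for c f g
      by (simp add: V_to_H_coord q_def polynomial_series_comp)
  qed
  then show "\<exists>D :: 'k H \<Rightarrow> 'k HH. is_Delta D" by blast
next
  fix D D' :: "'k H \<Rightarrow> 'k HH" assume D: "is_Delta D" "is_Delta D'"
  have "D (gen c) = D' (gen c)" for c
  proof -
    have "eval_HH (D (gen c) - D' (gen c)) f g = 0" for f g
    proof -
      have "eval_HH (D (gen c) - D' (gen c)) f g + eval_HH (D' (gen c)) f g = eval_HH (D (gen c)) f g"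
        by (simp add: eval_HH_ev ev_add[OF ring_map_id, symmetric])
      then show ?thesis using D by (simp add: is_Delta_def V_to_H_coord)
    qed
    then have "D (gen c) - D' (gen c) = 0" by (rule eval_HH_eq_0)
    then show ?thesis by simp
  qed
  then have "D \<circ> gen = D' \<circ> gen" by auto
  moreover have "D = lin (mon (D \<circ> gen))" "D' = lin (mon (D' \<circ> gen))"
    using D by (auto simp: is_Delta_def intro!: alg_hom_eq_lin)
  ultimately show "D = D'" by metis
qed

end

theory Submission
  imports Defs
begin

text \<open>Since \<open>X\<^sub>c(f \<circ> g)\<close> is linear in \<open>f\<close> up to the summand \<open>X\<^sub>c(g)\<close>, \<open>Delta_tilde (X\<^sub>c)\<close> is
  the sum over all words \<open>w\<close> of \<open>X\<^sub>w \<otimes> P(w, c)\<close>, where the polynomial \<open>P(w, c) = phi_poly w c\<close>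
  gives the coefficient of \<open>c\<close> in \<open>\<phi>\<^sub>g(w)(\<emptyset>)\<close>.  The claimed identities are the recursion of
  \<open>\<phi>\<^sub>g\<close> on the first letters of \<open>w\<close> and \<open>c\<close>; the second one also uses that the shuffle product
  is commutative.\<close>

section \<open>Linear maps on spaces with a given basis\<close>

abbreviation linear_map :: "(('a \<Rightarrow>\<^sub>0 'k::field) \<Rightarrow> ('b \<Rightarrow>\<^sub>0 'k)) \<Rightarrow> bool" where
  "linear_map \<equiv> Vector_Spaces.linear scl scl"

lemma linear_map_add: "linear_map F \<Longrightarrow> F (p + q) = F p + F q"
  by (simp add: linear_scl_iff)

lemma linear_map_scl: "linear_map F \<Longrightarrow> F (scl a p) = scl a (F p)"
  by (simp add: linear_scl_iff)

lemma linear_map_zero: "linear_map F \<Longrightarrow> F 0 = 0"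
  using linear_map_add[of F 0 0] by simp

lemma linear_map_sum: "linear_map F \<Longrightarrow> F (\<Sum>i\<in>A. p i) = (\<Sum>i\<in>A. F (p i))"
  by (induction A rule: infinite_finite_induct) (simp_all add: linear_map_add linear_map_zero)

lemma linear_map_lin [simp]: "linear_map (lin f)"
  by (simp add: linear_scl_iff lin_add lin_scl)

lemma linear_map_id [simp]: "linear_map id"
  by (simp add: linear_scl_iff)

lemma linear_map_comp: "linear_map F \<Longrightarrow> linear_map G \<Longrightarrow> linear_map (\<lambda>p. F (G p))"
  by (simp add: linear_scl_iff)

lemma scl_one [simp]: "scl 1 p = p"
  by (rule poly_mapping_eqI) simp

lemma scl_zero_left [simp]: "scl 0 p = 0"
  by (rule poly_mapping_eqI) simp

lemma scl_zero_right [simp]: "scl a 0 = 0"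
  by (rule poly_mapping_eqI) simp

lemma scl_nonzero: "scl a p \<noteq> 0 \<Longrightarrow> a \<noteq> 0"
  by auto

lemma scl_add_right: "scl a (p + q) = scl a p + scl a q"
  by (rule poly_mapping_eqI) (simp add: lookup_add algebra_simps)

lemma linear_map_plus: "linear_map F \<Longrightarrow> linear_map G \<Longrightarrow> linear_map (\<lambda>p. F p + G p)"
  by (simp add: linear_scl_iff scl_add_right algebra_simps)

lemma scl_sum_right: "scl a (\<Sum>i\<in>A. p i) = (\<Sum>i\<in>A. scl a (p i))"
  by (rule poly_mapping_eqI) (simp add: lookup_sum sum_distrib_left)

lemma linear_map_eqI:
  assumes "linear_map F" "linear_map G"
    and "\<And>a. F (Poly_Mapping.single a 1) = G (Poly_Mapping.single a 1)"
  shows "F p = G p"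
proof -
  have "F (Poly_Mapping.single a c) = G (Poly_Mapping.single a c)" for a c
    using linear_map_scl[OF assms(1), of c "Poly_Mapping.single a 1"]
      linear_map_scl[OF assms(2), of c "Poly_Mapping.single a 1"] assms(3) by simp
  then show ?thesis
    by (subst (1 2) poly_mapping_sum_single[of p])
       (simp add: linear_map_sum assms(1,2))
qed

text \<open>Two reductions to basis elements, first in \<open>p\<close> with \<open>q\<close> fixed,
  then in \<open>q\<close>.\<close>

lemma bilinear_map_eqI:
  assumes "\<And>q. linear_map (\<lambda>p. B p q)" "\<And>p. linear_map (B p)"
    and "\<And>q. linear_map (\<lambda>p. C p q)" "\<And>p. linear_map (C p)"
    and "\<And>a b. B (Poly_Mapping.single a 1) (Poly_Mapping.single b 1) =
      C (Poly_Mapping.single a 1) (Poly_Mapping.single b 1)"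
  shows "B p q = C p q"
proof (rule linear_map_eqI[of "\<lambda>p. B p q" "\<lambda>p. C p q"])
  show "B (Poly_Mapping.single a 1) q = C (Poly_Mapping.single a 1) q" for a
    by (rule linear_map_eqI) (use assms in auto)
qed (use assms in auto)

section \<open>Tensor products, their associator, and multiplication in \<open>H\<close>\<close>

lemma linear_map_tensor_left [simp]: "linear_map (\<lambda>p. tensor p q)"
  by (auto simp: linear_scl_iff tensor.rep_eq lookup_add algebra_simps intro!: poly_mapping_eqI)

lemma linear_map_tensor_right [simp]: "linear_map (tensor p)"
  by (auto simp: linear_scl_iff tensor.rep_eq lookup_add algebra_simps intro!: poly_mapping_eqI)

lemma tensor_single:
  "tensor (Poly_Mapping.single a x) (Poly_Mapping.single b y) = Poly_Mapping.single (a, b) (x * y)"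
  by (rule poly_mapping_eqI) (auto simp: tensor.rep_eq lookup_single when_def split: if_splits)

lemma linear_map_tensor_map [simp]: "linear_map (tensor_map F G)"
  by (simp add: tensor_map_def)

text \<open>\<open>tensor_map\<close> only reads the values of \<open>F\<close> and \<open>G\<close>
  on basis elements; linearity of both recovers the usual formula on all pure tensors.\<close>

lemma tensor_map_tensor:
  assumes "linear_map F" "linear_map G"
  shows "tensor_map F G (tensor p q) = tensor (F p) (G q)"
proof (rule bilinear_map_eqI[of "\<lambda>p q. tensor_map F G (tensor p q)" "\<lambda>p q. tensor (F p) (G q)"])
  show "linear_map (\<lambda>p. tensor_map F G (tensor p q))" for q
    by (rule linear_map_comp[of "tensor_map F G"]) auto
  show "linear_map (\<lambda>q. tensor_map F G (tensor p q))" for p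
    by (rule linear_map_comp[of "tensor_map F G"]) auto
  show "linear_map (\<lambda>p. tensor (F p) (G q))" for q
    by (rule linear_map_comp[of "\<lambda>p. tensor p (G q)"]) (use assms in auto)
  show "linear_map (\<lambda>q. tensor (F p) (G q))" for p
    by (rule linear_map_comp[of "tensor (F p)"]) (use assms in auto)
  show "tensor_map F G (tensor (Poly_Mapping.single a 1) (Poly_Mapping.single b 1)) =
      tensor (F (Poly_Mapping.single a 1)) (G (Poly_Mapping.single b 1))" for a b
    by (simp add: tensor_single tensor_map_def)
qed

lemma linear_map_tensor_assoc [simp]: "linear_map tensor_assoc"
  by (simp add: tensor_assoc_def)

text \<open>The first factor stays a basis element, as it will be some \<open>coord w\<close>; what
  remains is bilinear in \<open>q\<close> and \<open>r\<close>.\<close>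

lemma tensor_assoc_tensor_single:
  "tensor_assoc (tensor (tensor (Poly_Mapping.single a 1) q) r) =
    tensor (Poly_Mapping.single a 1) (tensor q r)"
proof (rule bilinear_map_eqI[of "\<lambda>q r. tensor_assoc (tensor (tensor (Poly_Mapping.single a 1) q) r)"
      "\<lambda>q r. tensor (Poly_Mapping.single a 1) (tensor q r)"])
  show "linear_map (\<lambda>q. tensor_assoc (tensor (tensor (Poly_Mapping.single a 1) q) r))" for r
    by (rule linear_map_comp[of tensor_assoc], simp)
       (rule linear_map_comp[of "\<lambda>p. tensor p r" "tensor (Poly_Mapping.single a 1)"], auto)
  show "linear_map (\<lambda>r. tensor_assoc (tensor (tensor (Poly_Mapping.single a 1) q) r))" for q
    by (rule linear_map_comp[of tensor_assoc]) auto
  show "linear_map (\<lambda>q. tensor (Poly_Mapping.single a 1) (tensor q r))" for r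
    by (rule linear_map_comp[of "tensor (Poly_Mapping.single a 1)" "\<lambda>q. tensor q r"]) auto
  show "linear_map (\<lambda>r. tensor (Poly_Mapping.single a 1) (tensor q r))" for q
    by (rule linear_map_comp[of "tensor (Poly_Mapping.single a 1)" "tensor q"]) auto
qed (simp add: tensor_single tensor_assoc_def)

lemma linear_map_mult_H [simp]: "linear_map mult_H"
  by (simp add: mult_H_def)

lemma linear_map_mult_left: "linear_map (\<lambda>p. p * (q :: 'k::field H))"
  by (simp add: linear_scl_iff scl_conv_mult algebra_simps)

lemma linear_map_mult_right: "linear_map ((*) (p :: 'k::field H))"
  by (simp add: linear_scl_iff scl_conv_mult algebra_simps)

lemma mult_H_tensor: "mult_H (tensor p q) = p * q"
proof (rule bilinear_map_eqI[of "\<lambda>p q. mult_H (tensor p q)" "(*)"])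
  show "linear_map (\<lambda>p. mult_H (tensor p q))" for q :: "'a H"
    by (rule linear_map_comp[of mult_H]) auto
  show "linear_map (\<lambda>q. mult_H (tensor p q))" for p :: "'a H"
    by (rule linear_map_comp[of mult_H]) auto
qed (simp_all add: linear_map_mult_left linear_map_mult_right tensor_single mult_H_def mult_single)

section \<open>The structure maps on coordinates, and symmetry of the shuffle\<close>

lemma linear_map_V_to_H [simp]: "linear_map V_to_H"
  by (simp add: V_to_H_def)

lemma linear_map_theta [simp]: "linear_map (theta a)"
  by (simp add: theta_def)

lemma theta_coord: "theta a (coord c) = coord (a # c)"
  by (simp add: theta_def coord_def)

lemma linear_map_VH_to_HH [simp]: "linear_map VH_to_HH"
  by (simp add: VH_to_HH_def)

lemma linear_map_Delta_shuffle [simp]: "linear_map Delta_shuffle"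
  by (simp add: Delta_shuffle_def)

text \<open>Shuffling preserves total length, so a pair with nonzero coefficient at \<open>c\<close>
  consists of words no longer than \<open>c\<close>. The square index set, larger than the support,
  allows the sums to be swapped later.\<close>

lemma Delta_shuffle_coord:
  "Delta_shuffle (coord c) = (\<Sum>u | length u \<le> length c. \<Sum>v | length v \<le> length c.
    scl (shuffle_word u v c) (tensor (coord u) (coord v)))"
proof -
  have "Sum_any (\<lambda>(u, v). scl (shuffle_word u v c) (tensor (coord u) (coord v) :: 'a VV)) =
    (\<Sum>(u, v)\<in>{u. length u \<le> length c} \<times> {v. length v \<le> length c}.
      scl (shuffle_word u v c) (tensor (coord u) (coord v)))"
    by (rule Sum_any.expand_superset) (auto dest!: scl_nonzero shuffle_word_length)
  then show ?thesis
    by (simp add: Delta_shuffle_def coord_def sum.cartesian_product)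
qed

lemma shuffle_word_commute: "shuffle_word u v = shuffle_word v u"
proof (induction u v rule: shuffle_word.induct)
  case (1 w)
  \<comment> \<open>The defining equation for an empty second word applies only to a nonempty first
    one, hence the case split.\<close>
  then show ?case by (cases w) auto
qed (auto simp: add.commute)

section \<open>An explicit formula for \<open>Delta_tilde\<close>\<close>

lemma phi_poly_zero: "length v < length w \<Longrightarrow> phi_poly w v = 0"
proof (induction w v rule: phi_poly.induct)
  case (3 a w b v)
  \<comment> \<open>In the shuffle part each \<open>t\<close> is no longer than \<open>v\<close>,
    hence shorter than \<open>w\<close>, so the induction hypothesis annihilates every
    summand.\<close>
  then show ?case by (auto intro!: sum.neutral)
qed auto

text \<open>The cutoff makes the sum over all words finite without changing it:
  \<open>phi_poly w c\<close> vanishes for \<open>w\<close> longer than \<open>c\<close>.\<close>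

definition comp_coord :: "word \<Rightarrow> 'k::field VH" where
  "comp_coord c = (\<Sum>w | length w \<le> length c. tensor (coord w) (phi_poly w c))"

lemma comp_coord_superset:
  assumes "length c \<le> n"
  shows "comp_coord c = (\<Sum>w | length w \<le> n. tensor (coord w) (phi_poly w c))"
  unfolding comp_coord_def
  by (rule sum.mono_neutral_left)
     (use assms in \<open>auto simp: phi_poly_zero linear_map_zero[OF linear_map_tensor_right]\<close>)

lemma is_Delta_Delta: "is_Delta (Delta :: 'k::field_char_0 H \<Rightarrow> 'k HH)"
  unfolding Delta_def by (rule theI'[OF ex1_Delta])

lemma linear_map_Delta: "linear_map (Delta :: 'k::field_char_0 H \<Rightarrow> 'k HH)"
  by (rule is_Delta_Delta[unfolded is_Delta_def, THEN conjunct1])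

text \<open>Both sides define the same polynomial function, the coefficient of \<open>c\<close> in
  the composition of two series. In characteristic zero the field is infinite, so the function
  determines the element of \<open>H \<otimes> H\<close>.\<close>

lemma Delta_gen:
  "Delta (gen c :: 'k::field_char_0 H) = VH_to_HH (comp_coord c) + tensor 1 (gen c)"
proof -
  define q :: "'k HH" where "q = VH_to_HH (comp_coord c) + tensor 1 (gen c)"
  have q: "q = (\<Sum>w | length w \<le> length c. tensor (gen w) (phi_poly w c)) + tensor 1 (gen c)"
    by (simp add: q_def comp_coord_def linear_map_sum)
       (simp add: VH_to_HH_def tensor_map_tensor V_to_H_coord)
  have "eval_HH (Delta (gen c) - q) f g = 0" for f g
  proof -
    have "eval_HH (Delta (gen c) - q) f g + eval_HH q f g = eval_HH (Delta (gen c)) f g"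
      by (simp add: eval_HH_ev ev_add[OF ring_map_id, symmetric])
    then show ?thesis
      using is_Delta_Delta[where 'k = 'k]
      unfolding is_Delta_def V_to_H_coord q polynomial_series_comp by simp
  qed
  then have "Delta (gen c) - q = 0" by (rule eval_HH_eq_0)
  then show ?thesis by (simp add: q_def)
qed

lemma VH_to_HH_lin_comp_coord:
  "VH_to_HH (lin comp_coord x) = Delta (V_to_H x) - tensor 1 (V_to_H (x :: 'k::field_char_0 V))"
proof -
  \<comment> \<open>The subtracted term is moved to the left, so that both sides are built from sums
    and compositions of linear maps and can be compared on coordinates.\<close>
  have "VH_to_HH (lin comp_coord x) + tensor 1 (V_to_H x) = Delta (V_to_H x)"
  proof (rule linear_map_eqI[of "\<lambda>x. VH_to_HH (lin comp_coord x) + tensor 1 (V_to_H x)"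
        "\<lambda>x. Delta (V_to_H x)"])
    show "linear_map (\<lambda>x. VH_to_HH (lin comp_coord x) + tensor 1 (V_to_H x) :: 'k HH)"
      by (rule linear_map_plus[OF linear_map_comp[of VH_to_HH] linear_map_comp[of "tensor 1"]]) auto
    show "linear_map (\<lambda>x. Delta (V_to_H x) :: 'k HH)"
      by (rule linear_map_comp[OF linear_map_Delta]) simp
    have "VH_to_HH (comp_coord c) + tensor 1 (V_to_H (coord c)) =
        Delta (V_to_H (coord c) :: 'k H)" for c
      by (simp add: V_to_H_coord Delta_gen)
    then show "VH_to_HH (lin comp_coord (Poly_Mapping.single c 1)) +
        tensor 1 (V_to_H (Poly_Mapping.single c 1)) =
        Delta (V_to_H (Poly_Mapping.single c 1) :: 'k H)" for c
      by (simp add: coord_def)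
  qed
  then show ?thesis by (simp add: eq_diff_eq)
qed

text \<open>\<open>lin comp_coord x\<close> satisfies the defining equation, and injectivity of
  \<open>VH_to_HH\<close> makes it the only solution, so the definite description denotes
  it.\<close>

lemma Delta_tilde_eq_lin: "(Delta_tilde :: 'k::field_char_0 V \<Rightarrow> 'k VH) = lin comp_coord"
proof
  fix x :: "'k V"
  show "Delta_tilde x = lin comp_coord x"
    unfolding Delta_tilde_def
    by (rule the_equality) (auto simp: VH_to_HH_lin_comp_coord[symmetric] inj_eq[OF inj_VH_to_HH])
qed

lemma linear_map_Delta_tilde [simp]: "linear_map (Delta_tilde :: 'k::field_char_0 V \<Rightarrow> 'k VH)"
  by (simp add: Delta_tilde_eq_lin)

lemma Delta_tilde_coord: "Delta_tilde (coord c :: 'k::field_char_0 V) = comp_coord c"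
  by (simp add: Delta_tilde_eq_lin coord_def)

section \<open>Recursion on the first letter of the coefficient word\<close>

lemma comp_coord_Cons:
  "comp_coord (b # c) =
    (\<Sum>w | length w \<le> length c. tensor (coord (x0 # w)) (phi_poly (x0 # w) (b # c))) +
    (\<Sum>w | length w \<le> length c. tensor (coord (x1 # w)) (phi_poly (x1 # w) (b # c)))"
proof -
  let ?f = "\<lambda>w. tensor (coord w) (phi_poly w (b # c))"
  let ?W = "{w :: word. length w \<le> length c}"
  have "{w :: word. length w \<le> length (b # c)} = insert [] ((#) x0 ` ?W \<union> (#) x1 ` ?W)"
  proof (rule set_eqI)
    fix w
    show "w \<in> {w. length w \<le> length (b # c)} \<longleftrightarrow> w \<in> insert [] ((#) x0 ` ?W \<union> (#) x1 ` ?W)"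
    proof (cases w)
      case (Cons a v)
      then show ?thesis by (cases a) auto
    qed simp
  qed
  then have "comp_coord (b # c) = sum ?f (insert [] ((#) x0 ` ?W \<union> (#) x1 ` ?W))"
    unfolding comp_coord_def by (rule sum.cong) simp
  \<comment> \<open>The empty word drops out because \<open>phi_poly []\<close> is zero at a
    nonempty word.\<close>
  also have "\<dots> = sum ?f ((#) x0 ` ?W \<union> (#) x1 ` ?W)"
    by (subst sum.insert) (auto simp: linear_map_zero[OF linear_map_tensor_right])
  also have "\<dots> = sum ?f ((#) x0 ` ?W) + sum ?f ((#) x1 ` ?W)"
    by (rule sum.union_disjoint) auto
  finally show ?thesis by (simp add: sum.reindex del: phi_poly.simps)
qed

lemma tensor_map_theta_comp_coord:
  "tensor_map (theta a) id (comp_coord c) =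
    (\<Sum>w | length w \<le> length c. tensor (coord (a # w)) (phi_poly w c))"
  by (simp add: comp_coord_def linear_map_sum tensor_map_tensor theta_coord)

text \<open>The free bound \<open>n\<close> gives all \<open>u\<close> occurring in the coproduct of
  one word the same range for \<open>w\<close>, which is what swapping the sums requires.\<close>

lemma theta1_mult_comp_coord:
  assumes "length u \<le> n"
  shows "tensor_map (theta x1) mult_H (tensor_assoc (tensor (comp_coord u) (gen v))) =
    (\<Sum>w | length w \<le> n. tensor (coord (x1 # w)) (gen v * phi_poly w u))"
  unfolding comp_coord_superset[OF assms] linear_map_sum[OF linear_map_tensor_left]
  by (simp add: linear_map_sum coord_def tensor_assoc_tensor_single tensor_map_tensor mult_H_tensor
      mult.commute theta_coord[unfolded coord_def])

text \<open>A leading \<open>x0\<close> in the coefficient word comes either from a leading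
  \<open>x0\<close> of \<open>w\<close>, which gives the \<open>theta x0\<close> term, or from the
  summand \<open>x\<^sub>0 (d \<squnion> X)\<close> of the action of \<open>x1\<close>, written with
  \<open>\<squnion>\<close> for the shuffle, which gives the double sum.\<close>

lemma comp_coord_x0:
  "comp_coord (x0 # c) = tensor_map (theta x0) id (comp_coord c) +
    (\<Sum>u | length u \<le> length c. \<Sum>v | length v \<le> length c. scl (shuffle_word u v c)
      (tensor_map (theta x1) mult_H (tensor_assoc (tensor (comp_coord u) (gen v)))))"
proof -
  let ?W = "{w :: word. length w \<le> length c}"
  \<comment> \<open>In \<open>phi_poly\<close> the generator belongs to the first shuffle argument,
    but \<open>Delta_tilde\<close> acts on the first tensor factor of the coproduct; commutativity
    of the shuffle exchanges the two roles.\<close>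
  have "(\<Sum>w\<in>?W. tensor (coord (x1 # w)) (phi_poly (x1 # w) (x0 # c))) =
      (\<Sum>w\<in>?W. \<Sum>v\<in>?W. \<Sum>u\<in>?W. scl (shuffle_word u v c)
        (tensor (coord (x1 # w)) (gen v * phi_poly w u) :: 'a VH))"
    by (simp add: linear_map_sum linear_map_scl shuffle_word_commute)
  \<comment> \<open>The sum over \<open>w\<close> moves innermost, where it becomes the expansion of
    \<open>comp_coord u\<close>.\<close>
  also have "\<dots> = (\<Sum>w\<in>?W. \<Sum>u\<in>?W. \<Sum>v\<in>?W. scl (shuffle_word u v c)
        (tensor (coord (x1 # w)) (gen v * phi_poly w u)))"
    by (intro sum.cong refl sum.swap)
  also have "\<dots> = (\<Sum>u\<in>?W. \<Sum>w\<in>?W. \<Sum>v\<in>?W. scl (shuffle_word u v c)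
        (tensor (coord (x1 # w)) (gen v * phi_poly w u)))"
    by (rule sum.swap)
  also have "\<dots> = (\<Sum>u\<in>?W. \<Sum>v\<in>?W. \<Sum>w\<in>?W. scl (shuffle_word u v c)
        (tensor (coord (x1 # w)) (gen v * phi_poly w u)))"
    by (intro sum.cong refl sum.swap)
  also have "\<dots> = (\<Sum>u\<in>?W. \<Sum>v\<in>?W. scl (shuffle_word u v c)
      (tensor_map (theta x1) mult_H (tensor_assoc (tensor (comp_coord u) (gen v)))))"
    by (intro sum.cong refl) (simp add: theta1_mult_comp_coord[of _ "length c"] scl_sum_right)
  finally show ?thesis
    by (simp add: comp_coord_Cons tensor_map_theta_comp_coord)
qed

text \<open>The action of \<open>x0\<close> only produces words starting with \<open>x0\<close>, and
  so does the shuffle part of the action of \<open>x1\<close>; a leading \<open>x1\<close> can only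
  come from the letter \<open>x1\<close> itself.\<close>

lemma comp_coord_x1: "comp_coord (x1 # c) = tensor_map (theta x1) id (comp_coord c)"
  by (simp add: comp_coord_Cons tensor_map_theta_comp_coord
      linear_map_zero[OF linear_map_tensor_right])

theorem proposition3:
  shows "(\<forall>x :: 'k::field_char_0 V.
            VH_to_HH (Delta_tilde x) = Delta (V_to_H x) - tensor 1 (V_to_H x))
       \<and> Delta_tilde (coord [] :: 'k V) = tensor (coord []) 1
       \<and> (Delta_tilde \<circ> theta x0 :: 'k V \<Rightarrow> 'k VH) =
           (\<lambda>x. (tensor_map (theta x0) id \<circ> Delta_tilde) x +
                (tensor_map (theta x1) mult_H \<circ> tensor_assoc \<circ>
                  tensor_map Delta_tilde V_to_H \<circ> Delta_shuffle) x)
       \<and> (Delta_tilde \<circ> theta x1 :: 'k V \<Rightarrow> 'k VH) = tensor_map (theta x1) id \<circ> Delta_tilde"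
proof (intro conjI allI)
  show "VH_to_HH (Delta_tilde x) = Delta (V_to_H x) - tensor 1 (V_to_H x)" for x :: "'k V"
    by (simp add: Delta_tilde_eq_lin VH_to_HH_lin_comp_coord)
next
  show "Delta_tilde (coord [] :: 'k V) = tensor (coord []) 1"
    \<comment> \<open>Only the empty word meets the length bound \<open>0\<close>, and
      \<open>phi_poly [] []\<close> is \<open>1\<close>.\<close>
    by (simp add: Delta_tilde_coord comp_coord_def)
next
  let ?S = "\<lambda>x :: 'k V. tensor_map (theta x1) mult_H
    (tensor_assoc (tensor_map Delta_tilde V_to_H (Delta_shuffle x)))"
  have S: "linear_map ?S"
    by (rule linear_map_comp[OF linear_map_tensor_map linear_map_comp[OF linear_map_tensor_assoc
          linear_map_comp[OF linear_map_tensor_map linear_map_Delta_shuffle]]])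
  have "Delta_tilde (theta x0 x) = tensor_map (theta x0) id (Delta_tilde x) + ?S x" for x
  proof (rule linear_map_eqI[of "\<lambda>x. Delta_tilde (theta x0 x)"
        "\<lambda>x. tensor_map (theta x0) id (Delta_tilde x) + ?S x"])
    show "linear_map (\<lambda>x. Delta_tilde (theta x0 x) :: 'k VH)"
      by (rule linear_map_comp[OF linear_map_Delta_tilde linear_map_theta])
    show "linear_map (\<lambda>x. tensor_map (theta x0) id (Delta_tilde x) + ?S x)"
      by (rule linear_map_plus[OF linear_map_comp[OF linear_map_tensor_map linear_map_Delta_tilde] S])
    \<comment> \<open>On a coordinate, expanding the coproduct turns \<open>?S\<close> into the
      double sum of \<open>comp_coord_x0\<close>.\<close>
    have "Delta_tilde (theta x0 (coord c)) =
        tensor_map (theta x0) id (Delta_tilde (coord c)) + ?S (coord c)" for c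
      by (simp add: Delta_shuffle_coord linear_map_sum linear_map_scl tensor_map_tensor
          theta_coord Delta_tilde_coord V_to_H_coord comp_coord_x0)
    then show "Delta_tilde (theta x0 (Poly_Mapping.single c 1)) =
        tensor_map (theta x0) id (Delta_tilde (Poly_Mapping.single c 1)) +
        ?S (Poly_Mapping.single c 1)" for c
      unfolding coord_def .
  qed
  then show "(Delta_tilde \<circ> theta x0 :: 'k V \<Rightarrow> 'k VH) =
           (\<lambda>x. (tensor_map (theta x0) id \<circ> Delta_tilde) x +
                (tensor_map (theta x1) mult_H \<circ> tensor_assoc \<circ>
                  tensor_map Delta_tilde V_to_H \<circ> Delta_shuffle) x)"
    by (simp add: fun_eq_iff)
next
  have "Delta_tilde (theta x1 x) = tensor_map (theta x1) id (Delta_tilde x)" for x :: "'k V"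
  proof (rule linear_map_eqI[of "\<lambda>x. Delta_tilde (theta x1 x)"
        "\<lambda>x. tensor_map (theta x1) id (Delta_tilde x)"])
    show "linear_map (\<lambda>x. Delta_tilde (theta x1 x) :: 'k VH)"
      by (rule linear_map_comp[OF linear_map_Delta_tilde linear_map_theta])
    show "linear_map (\<lambda>x. tensor_map (theta x1) id (Delta_tilde x) :: 'k VH)"
      by (rule linear_map_comp[OF linear_map_tensor_map linear_map_Delta_tilde])
    have "Delta_tilde (theta x1 (coord c)) =
        tensor_map (theta x1) id (Delta_tilde (coord c) :: 'k VH)" for c
      by (simp add: theta_coord Delta_tilde_coord comp_coord_x1)
    then show "Delta_tilde (theta x1 (Poly_Mapping.single c 1)) =
        tensor_map (theta x1) id (Delta_tilde (Poly_Mapping.single c 1) :: 'k VH)" for c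
      unfolding coord_def .
  qed
  then show "(Delta_tilde \<circ> theta x1 :: 'k V \<Rightarrow> 'k VH) = tensor_map (theta x1) id \<circ> Delta_tilde"
    by (simp add: fun_eq_iff)
qed

end
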